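(* For all $\sigma\in(0,\infty)$, $$B(\mathcal{F}_\sigma)=1,$$ that is, $\sup_{G\in\mathcal{F}_\sigma}B(G)=1$.
   Context: For $\sigma\in(0,\infty)$, $\mathcal{F}_\sigma$ is the collection of probability distributions on $\mathbb{R}$ with mean zero, variance $\sigma^2$ and finite absolute third moment. Zero bias distribution: for a random variable $X$ with mean zero and finite nonzero variance $\sigma^2$, there is a unique distribution for a random variable $X^*$ such that $\sigma^2E f'(X^* )=E[Xf(X)]$ for all absolutely continuous functions $f$ for which these expectations exist; it is called the $X$-zero bias distribution. It is absolutely continuous; if $X$ has distribution $G$, then $X^*$ has distribution function $G^*(x)=\sigma^{-2}E[X(X-x)\mathbf{1}(X\le x)]$ and density $g^*(x)=\sigma^{-2}E[X\mathbf{1}(X>x)]$. For distribution functions $F,G$, $\|F-G\|_1=\int_{-\infty}^\infty|F(x)-G(x)|\,dx$. For $X$ with distribution $G$ having mean zero, variance $\sigma^2\in(0,\infty)$ and finite absolute third moment, $$B(G)=\frac{2\sigma^2\|G^*-G\|_1}{E|X|^3},$$ and for a collection $\mathcal{F}$ of such distributions, $B(\mathcal{F})=\sup_{G\in\mathcal{F}}B(G)$. *)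

theory Defs
  imports "HOL-Probability.Probability"
begin

definition abs_continuous_on_interval :: "real \<Rightarrow> real \<Rightarrow> (real \<Rightarrow> real) \<Rightarrow> bool" where
  "abs_continuous_on_interval a b f \<longleftrightarrow>
     (\<forall>\<epsilon>>0. \<exists>\<delta>>0. \<forall>P :: (real \<times> real) set.
        finite P \<and> (\<forall>(x, y)\<in>P. a \<le> x \<and> x \<le> y \<and> y \<le> b) \<and>
        pairwise (\<lambda>p q. disjnt {fst p<..<snd p} {fst q<..<snd q}) P \<and>
        (\<Sum>(x, y)\<in>P. y - x) < \<delta> \<longrightarrow>
        (\<Sum>(x, y)\<in>P. \<bar>f y - f x\<bar>) < \<epsilon>)"

text \<open>As usual for functions on the whole real line, absolute continuity is meant locally, that
  is, on every compact interval; this includes every function of the form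
  \<open>f(x) = c + \<integral>\<^sub>0\<^sup>x h\<close> with \<open>h\<close> locally integrable.\<close>

definition abs_continuous_fun :: "(real \<Rightarrow> real) \<Rightarrow> bool" where
  "abs_continuous_fun f \<longleftrightarrow> (\<forall>a b. a \<le> b \<longrightarrow> abs_continuous_on_interval a b f)"

text \<open>A distribution is a Borel probability measure \<open>G\<close> on the reals, namely the law of \<open>X\<close>.\<close>

definition dist_mean :: "real measure \<Rightarrow> real" where
  "dist_mean G = (\<integral>x. x \<partial>G)"

definition dist_variance :: "real measure \<Rightarrow> real" where
  "dist_variance G = (\<integral>x. (x - dist_mean G)\<^sup>2 \<partial>G)"

definition abs_third_moment :: "real measure \<Rightarrow> real" where
  "abs_third_moment G = (\<integral>x. \<bar>x\<bar> ^ 3 \<partial>G)"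

text \<open>\<open>N\<close> is an \<open>X\<close>-zero bias distribution, where \<open>X\<close> has law \<open>G\<close>. An absolutely continuous \<open>f\<close> is
  differentiable only almost everywhere, so its derivative is represented by any function \<open>f'\<close>
  agreeing with it Lebesgue-almost everywhere; the integrability assumptions say that the two
  expectations exist. The identity for every version \<open>f'\<close> forces \<open>N\<close> to have a Lebesgue density.\<close>

definition is_zero_bias :: "real measure \<Rightarrow> real measure \<Rightarrow> bool" where
  "is_zero_bias G N \<longleftrightarrow> real_distribution N \<and>
     (\<forall>f f'. abs_continuous_fun f \<longrightarrow>
        (AE x in lborel. (f has_real_derivative f' x) (at x)) \<longrightarrow>
        integrable N f' \<longrightarrow> integrable G (\<lambda>x. x * f x) \<longrightarrow>
        dist_variance G * (\<integral>x. f' x \<partial>N) = (\<integral>x. x * f x \<partial>G))"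

text \<open>Meaningful for \<open>G\<close> with mean zero and finite nonzero variance, where existence and
  uniqueness hold.\<close>

definition zero_bias :: "real measure \<Rightarrow> real measure" where
  "zero_bias G = (THE N. is_zero_bias G N)"

definition L1_dist :: "(real \<Rightarrow> real) \<Rightarrow> (real \<Rightarrow> real) \<Rightarrow> ennreal" where
  "L1_dist F G = (\<integral>\<^sup>+x. ennreal \<bar>F x - G x\<bar> \<partial>lborel)"

definition B_functional :: "real measure \<Rightarrow> ennreal" where
  "B_functional G =
     ennreal (2 * dist_variance G) * L1_dist (cdf (zero_bias G)) (cdf G)
       / ennreal (abs_third_moment G)"

definition B_collection :: "real measure set \<Rightarrow> ennreal" where
  "B_collection \<F> = (SUP G\<in>\<F>. B_functional G)"

text \<open>The first two integrability conditions follow from the third; they are listed so that mean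
  and variance are visibly genuine integrals rather than the default value \<open>0\<close>.\<close>

definition F_class :: "real \<Rightarrow> real measure set" where
  "F_class \<sigma> = {G. real_distribution G \<and>
     integrable G (\<lambda>x. x) \<and> integrable G (\<lambda>x. x\<^sup>2) \<and> integrable G (\<lambda>x. \<bar>x\<bar> ^ 3) \<and>
     dist_mean G = 0 \<and> dist_variance G = \<sigma>\<^sup>2}"

end

theory Submission
  imports Defs
begin

text \<open>
  Let \<open>X\<close>, \<open>Y\<close> be independent with law \<open>G\<close>. Testing the zero bias identity with \<open>min(\<cdot>, t)\<close> gives
  \<open>\<sigma>\<^sup>2 G\<^sup>*(t) = E[X min(X, t)]\<close>, so \<open>\<sigma>\<^sup>2 (G\<^sup>*(t) - G(t))\<close> is the covariance of \<open>X\<^sup>2 - t X\<close> and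
  \<open>1(X \<le> t)\<close>, and hence
  \<open>2 \<sigma>\<^sup>2 (G\<^sup>*(t) - G(t)) = E[(X - Y) (X + Y - t) (1(X \<le> t) - 1(Y \<le> t))]\<close>.
  Taking absolute values inside and integrating over \<open>t\<close> turns the right-hand side into
  \<open>E[(X - Y) (X|X| - Y|Y|)] / 2\<close>, the covariance of \<open>X\<close> and \<open>X|X|\<close>, which is \<open>E|X|\<^sup>3\<close>.
  Hence \<open>B(G) \<le> 1\<close>. For the uniform law on \<open>{\<sigma>, -\<sigma>}\<close> the integrand vanishes unless \<open>Y = -X\<close>,
  where it takes a single value by symmetry, so nothing is lost and \<open>B(G) = 1\<close>.

  The zero bias law exists as the second marginal of the measure with density
  \<open>\<sigma>\<^sup>-\<^sup>2 |x| 1(t between 0 and x)\<close> with respect to \<open>G(dx) dt\<close>: integrating \<open>f'(t)\<close> over \<open>t\<close> gives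
  \<open>\<sigma>\<^sup>-\<^sup>2 x (f(x) - f(0))\<close>, by the fundamental theorem of calculus for absolutely continuous \<open>f\<close>.
\<close>

section \<open>The fundamental theorem of calculus for absolutely continuous functions\<close>

lemma measure_lebesgue_division:
  assumes "\<D> division_of S"
  shows "measure lebesgue S = sum (measure lborel) \<D>"
proof -
  note \<D> = division_ofD[OF assms]
  have "negligible (K \<inter> L)" if "K \<in> \<D>" "L \<in> \<D>" "K \<noteq> L" for K L
  proof -
    have "convex (K \<inter> L)"
      using \<D>(4)[OF that(1)] \<D>(4)[OF that(2)] by (auto intro: convex_Int)
    then show ?thesis
      using \<D>(5)[OF that] by (simp add: negligible_convex_interior)
  qed
  moreover have "K \<in> lmeasurable" "measure lebesgue K = measure lborel K" if "K \<in> \<D>" for K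
    using \<D>(4)[OF that] by (auto simp: measure_completion)
  ultimately have "measure lebesgue (\<Union>\<D>) = sum (measure lborel) \<D>"
    using \<D>(1) by (simp add: measure_negligible_finite_Union pairwise_def)
  then show ?thesis using \<D>(6) by simp
qed

lemma negligible_outer_open:
  assumes "negligible N" "0 < e"
  obtains U where "open U" "N \<subseteq> U" "U \<in> lmeasurable" "measure lebesgue U < e"
proof -
  have N: "N \<in> null_sets lebesgue"
    using assms(1) by (simp add: negligible_iff_null_sets)
  then obtain U where U: "open U" "N \<subseteq> U" "U - N \<in> lmeasurable"
      "emeasure lebesgue (U - N) < ennreal e"
    using sets_lebesgue_outer_open[OF _ \<open>0 < e\<close>] by blast
  have emeasure_U: "emeasure lebesgue U = emeasure lebesgue (U - N)"
    using U(1) by (intro emeasure_Diff_null_set[OF N, symmetric]) simp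
  have "emeasure lebesgue U < \<infinity>"
    using U(4) unfolding emeasure_U by (rule order.strict_trans) simp
  then have "U \<in> lmeasurable"
    using U(1) by (intro fmeasurableI) simp
  moreover from this have "ennreal (measure lebesgue U) < ennreal e"
    using U(4) by (simp only: emeasure_U emeasure_eq_measure2[symmetric])
  ultimately show thesis using U(1,2) \<open>0 < e\<close> that by (simp add: ennreal_less_iff)
qed

lemma division_of_real_interval:
  fixes K :: "real set"
  assumes "\<D> division_of S" "K \<in> \<D>"
  shows "K = {Inf K..Sup K}" "Inf K \<le> Sup K"
  using division_ofD(3,4)[OF assms] by fastforce+

lemma abs_continuous_on_interval_division:
  assumes "abs_continuous_on_interval a b f" "0 < \<epsilon>"
  obtains \<delta> where "0 < \<delta>"
    "\<And>\<D> S. \<D> division_of S \<Longrightarrow> S \<subseteq> {a..b} \<Longrightarrow> sum (measure lborel) \<D> < \<delta> \<Longrightarrow>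
      (\<Sum>K\<in>\<D>. \<bar>f (Sup K) - f (Inf K)\<bar>) < \<epsilon>"
proof -
  obtain \<delta> where "0 < \<delta>" and \<delta>: "\<And>P :: (real \<times> real) set. finite P \<Longrightarrow>
      (\<forall>(x, y)\<in>P. a \<le> x \<and> x \<le> y \<and> y \<le> b) \<Longrightarrow>
      pairwise (\<lambda>p q. disjnt {fst p<..<snd p} {fst q<..<snd q}) P \<Longrightarrow>
      (\<Sum>(x, y)\<in>P. y - x) < \<delta> \<Longrightarrow> (\<Sum>(x, y)\<in>P. \<bar>f y - f x\<bar>) < \<epsilon>"
    using assms unfolding abs_continuous_on_interval_def by (metis (no_types, lifting))
  show thesis
  proof (rule that[OF \<open>0 < \<delta>\<close>])
    fix \<D> S
    assume "\<D> division_of S" and S: "S \<subseteq> {a..b}" and total_length: "sum (measure lborel) \<D> < \<delta>"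
    note \<D> = division_ofD[OF \<open>\<D> division_of S\<close>]
    note interval = division_of_real_interval[OF \<open>\<D> division_of S\<close>]
    define endpoints :: "real set \<Rightarrow> real \<times> real" where "endpoints K = (Inf K, Sup K)" for K
    have inj: "inj_on endpoints \<D>"
      using interval(1) by (metis (no_types, lifting) endpoints_def inj_onI prod.inject)
    have sum_endpoints: "sum h (endpoints ` \<D>) = (\<Sum>K\<in>\<D>. h (Inf K, Sup K))" for h :: "_ \<Rightarrow> real"
      unfolding sum.reindex[OF inj] by (simp add: endpoints_def)
    have "(\<Sum>(x, y)\<in>endpoints ` \<D>. \<bar>f y - f x\<bar>) < \<epsilon>"
    proof (rule \<delta>)
      show "finite (endpoints ` \<D>)" using \<D>(1) by simp
      have "a \<le> Inf K \<and> Inf K \<le> Sup K \<and> Sup K \<le> b" if "K \<in> \<D>" for K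
        using interval[OF that] \<D>(2)[OF that] S
        by (metis atLeastAtMost_iff atLeastatMost_subset_iff order.trans)
      then show "\<forall>(x, y)\<in>endpoints ` \<D>. a \<le> x \<and> x \<le> y \<and> y \<le> b"
        by (auto simp: endpoints_def)
      have "disjnt {Inf K<..<Sup K} {Inf L<..<Sup L}" if "K \<in> \<D>" "L \<in> \<D>" "K \<noteq> L" for K L
        using \<D>(5)[OF that] interval(1)[OF that(1)] interval(1)[OF that(2)]
        by (metis disjnt_def interior_atLeastAtMost_real)
      then show "pairwise (\<lambda>p q. disjnt {fst p<..<snd p} {fst q<..<snd q}) (endpoints ` \<D>)"
        by (auto simp: pairwise_image pairwise_def endpoints_def)
      have "measure lborel K = Sup K - Inf K" if "K \<in> \<D>" for K
        using interval[OF that] by (metis measure_lborel_Icc)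
      then show "(\<Sum>(x, y)\<in>endpoints ` \<D>. y - x) < \<delta>"
        using total_length by (simp add: sum_endpoints)
    qed
    then show "(\<Sum>K\<in>\<D>. \<bar>f (Sup K) - f (Inf K)\<bar>) < \<epsilon>"
      by (simp add: sum_endpoints)
  qed
qed

lemma sum_tagged_partial_division_real:
  fixes \<phi> :: "real set \<Rightarrow> real"
  assumes "p tagged_partial_division_of S" and singleton: "\<And>c. \<phi> {c} = 0"
  shows "(\<Sum>(x, K)\<in>p. \<phi> K) = (\<Sum>K\<in>snd ` p. \<phi> K)"
proof -
  have tagged: "p tagged_division_of \<Union>(snd ` p)"
    using assms(1) by (rule tagged_partial_division_of_Union_self)
  \<comment> \<open>\<open>Sup {}\<close> and \<open>Inf {}\<close> are unspecified reals, so \<open>\<phi> {}\<close> need not vanish.\<close>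
  define \<psi> where "\<psi> K = (if K = {} then 0 else \<phi> K)" for K
  have \<psi>: "\<phi> K = \<psi> K" if "(x, K) \<in> p" for x K
    using tagged_division_ofD(2)[OF tagged that] by (auto simp: \<psi>_def)
  have degenerate: "\<psi> (cbox u v) = 0" if "box u v = {}" for u v
    using that singleton by (cases "u = v") (auto simp: \<psi>_def)
  have "(\<Sum>(x, K)\<in>p. \<phi> K) = (\<Sum>(x, K)\<in>p. \<psi> K)"
    using \<psi> by (intro sum.cong) auto
  also have "\<dots> = (\<Sum>K\<in>snd ` p. \<psi> K)"
    using degenerate by (rule sum.over_tagged_division_lemma[where d = \<psi>, OF tagged])
  also have "\<dots> = (\<Sum>K\<in>snd ` p. \<phi> K)"
    using \<psi> by (intro sum.cong) auto
  finally show ?thesis .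
qed

lemma abs_continuous_on_interval_small_variation_near_negligible:
  assumes "abs_continuous_on_interval a b f" "negligible N" "0 < \<epsilon>"
  obtains U where "open U" "N \<subseteq> U"
    "\<And>p. p tagged_partial_division_of {a..b} \<Longrightarrow> (\<And>x K. (x, K) \<in> p \<Longrightarrow> K \<subseteq> U) \<Longrightarrow>
      (\<Sum>(x, K)\<in>p. \<bar>f (Sup K) - f (Inf K)\<bar>) < \<epsilon>"
proof -
  obtain \<delta> where "0 < \<delta>" and \<delta>: "\<And>\<D> S. \<D> division_of S \<Longrightarrow> S \<subseteq> {a..b} \<Longrightarrow>
      sum (measure lborel) \<D> < \<delta> \<Longrightarrow> (\<Sum>K\<in>\<D>. \<bar>f (Sup K) - f (Inf K)\<bar>) < \<epsilon>"
    using abs_continuous_on_interval_division[OF assms(1,3)] by blast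
  obtain U where U: "open U" "N \<subseteq> U" "U \<in> lmeasurable" "measure lebesgue U < \<delta>"
    using negligible_outer_open[OF \<open>negligible N\<close> \<open>0 < \<delta>\<close>] by blast
  show thesis
  proof (rule that[OF U(1,2)])
    fix p
    assume p: "p tagged_partial_division_of {a..b}" and K: "\<And>x K. (x, K) \<in> p \<Longrightarrow> K \<subseteq> U"
    have division: "snd ` p division_of \<Union>(snd ` p)"
      using p by (intro division_of_tagged_division tagged_partial_division_of_Union_self)
    have "sum (measure lborel) (snd ` p) = measure lebesgue (\<Union>(snd ` p))"
      using division by (rule measure_lebesgue_division[symmetric])
    also have "\<dots> \<le> measure lebesgue U"
      using K U(3) lmeasurable_division[OF division]
      by (intro measure_mono_fmeasurable) fastforce+
    finally have total_length: "sum (measure lborel) (snd ` p) < \<delta>" using U(4) by simp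
    have "(\<Sum>(x, K)\<in>p. \<bar>f (Sup K) - f (Inf K)\<bar>) = (\<Sum>K\<in>snd ` p. \<bar>f (Sup K) - f (Inf K)\<bar>)"
      using p by (rule sum_tagged_partial_division_real) simp
    also have "\<dots> < \<epsilon>"
      using tagged_partial_division_ofD(3)[OF p]
      by (intro \<delta>[OF division _ total_length]) fastforce
    finally show "(\<Sum>(x, K)\<in>p. \<bar>f (Sup K) - f (Inf K)\<bar>) < \<epsilon>" .
  qed
qed

lemma has_real_derivative_straddle:
  assumes "(f has_real_derivative D) (at x)" "0 < \<epsilon>"
  obtains d where "0 < d"
    "\<And>u v. u \<le> x \<Longrightarrow> x \<le> v \<Longrightarrow> {u..v} \<subseteq> ball x d \<Longrightarrow>
      \<bar>(v - u) * D - (f v - f u)\<bar> \<le> \<epsilon> * (v - u)"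
proof -
  obtain d where "0 < d"
    and d: "\<And>y. \<bar>y - x\<bar> < d \<Longrightarrow> \<bar>f y - f x - D * (y - x)\<bar> \<le> \<epsilon> * \<bar>y - x\<bar>"
    using assms by (auto simp: has_field_derivative_def has_derivative_at_alt)
  show thesis
  proof (rule that[OF \<open>0 < d\<close>])
    fix u v assume "u \<le> x" "x \<le> v" "{u..v} \<subseteq> ball x d"
    moreover from this have "u \<in> ball x d" "v \<in> ball x d"
      by (meson atLeastAtMost_iff order_refl order_trans subsetD)+
    ultimately have "\<bar>f u - f x - D * (u - x)\<bar> \<le> \<epsilon> * (x - u)"
        "\<bar>f v - f x - D * (v - x)\<bar> \<le> \<epsilon> * (v - x)"
      using d[of u] d[of v] by (auto simp: dist_real_def)
    then show "\<bar>(v - u) * D - (f v - f u)\<bar> \<le> \<epsilon> * (v - u)"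
      by (auto simp: algebra_simps abs_le_iff)
  qed
qed

lemma Riemann_sum_straddle_error:
  fixes f g d :: "real \<Rightarrow> real"
  assumes "a \<le> b" and "0 \<le> \<eta>" and p: "p tagged_division_of {a..b}"
    and fine: "(\<lambda>x. ball x (d x)) fine p"
    and zero: "\<And>x. x \<in> N \<Longrightarrow> g x = 0"
    and straddle: "\<And>x u v. x \<in> {a..b} - N \<Longrightarrow> u \<le> x \<Longrightarrow> x \<le> v \<Longrightarrow> {u..v} \<subseteq> ball x (d x) \<Longrightarrow>
      \<bar>(v - u) * g x - (f v - f u)\<bar> \<le> \<eta> * (v - u)"
  shows "\<bar>(\<Sum>(x, K)\<in>p. measure lborel K * g x) - (f b - f a)\<bar>
    \<le> \<eta> * (b - a) + (\<Sum>(x, K) | (x, K) \<in> p \<and> x \<in> N. \<bar>f (Sup K) - f (Inf K)\<bar>)"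
proof -
  define q where "q = {(x, K). (x, K) \<in> p \<and> x \<in> N}"
  define error where "error = (\<lambda>(x, K). measure lborel K * g x - (f (Sup K) - f (Inf K)))"
  have "finite p" using p by blast
  have "q \<subseteq> p" by (auto simp: q_def)
  have regular: "\<bar>error (x, K)\<bar> \<le> \<eta> * measure lborel K" if "(x, K) \<in> p - q" for x K
  proof -
    have xK: "(x, K) \<in> p" and "x \<notin> N" using that by (auto simp: q_def)
    obtain u v where K: "K = {u..v}" using tagged_division_ofD(4)[OF p xK] by auto
    have x: "u \<le> x" "x \<le> v" using tagged_division_ofD(2)[OF p xK] K by auto
    have "x \<in> {a..b} - N"
      using tagged_division_ofD(2,3)[OF p xK] \<open>x \<notin> N\<close> by blast
    moreover have "{u..v} \<subseteq> ball x (d x)" using fine xK K by (auto simp: fine_def)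
    ultimately show ?thesis
      using straddle[OF _ x] x by (simp add: error_def K)
  qed
  have "(\<Sum>(x, K)\<in>p. measure lborel K * g x) - (f b - f a) = sum error p"
    using additive_tagged_division_1[OF \<open>a \<le> b\<close> p, of f]
    by (simp add: error_def split_def sum_subtractf)
  also have "\<bar>\<dots>\<bar> \<le> (\<Sum>r\<in>p. \<bar>error r\<bar>)" by (rule sum_abs)
  also have "\<dots> = (\<Sum>r\<in>p - q. \<bar>error r\<bar>) + (\<Sum>r\<in>q. \<bar>error r\<bar>)"
    by (rule sum.subset_diff[OF \<open>q \<subseteq> p\<close> \<open>finite p\<close>])
  also have "(\<Sum>r\<in>q. \<bar>error r\<bar>) = (\<Sum>(x, K)\<in>q. \<bar>f (Sup K) - f (Inf K)\<bar>)"
    using zero by (intro sum.cong) (auto simp: error_def q_def)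
  also have "(\<Sum>r\<in>p - q. \<bar>error r\<bar>) \<le> (\<Sum>(x, K)\<in>p - q. \<eta> * measure lborel K)"
    using regular by (intro sum_mono) auto
  also have "\<dots> \<le> (\<Sum>(x, K)\<in>p. \<eta> * measure lborel K)"
    using \<open>finite p\<close> \<open>0 \<le> \<eta>\<close> by (intro sum_mono2) auto
  also have "\<dots> = \<eta> * (b - a)"
    using additive_content_tagged_division[of p a b] p \<open>a \<le> b\<close>
    by (simp add: split_def sum_distrib_left[symmetric])
  finally show ?thesis by (simp add: q_def)
qed

text \<open>Near the exceptional null set the gauge confines intervals to an open set of small measure,
  where absolute continuity bounds the variation of \<open>f\<close>; elsewhere the derivative controls \<open>f\<close>.\<close>

lemma abs_continuous_on_interval_straddle_gauge:
  fixes f f' :: "real \<Rightarrow> real"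
  assumes ac: "abs_continuous_on_interval a b f" and N: "negligible N"
    and deriv: "\<And>x. x \<in> {a..b} - N \<Longrightarrow> (f has_real_derivative f' x) (at x)"
    and "0 < \<eta>" "0 < \<epsilon>"
  obtains d where "\<And>x. 0 < d x"
    "\<And>x u v. x \<in> {a..b} - N \<Longrightarrow> u \<le> x \<Longrightarrow> x \<le> v \<Longrightarrow> {u..v} \<subseteq> ball x (d x) \<Longrightarrow>
      \<bar>(v - u) * f' x - (f v - f u)\<bar> \<le> \<eta> * (v - u)"
    "\<And>p. p tagged_partial_division_of {a..b} \<Longrightarrow> (\<lambda>x. ball x (d x)) fine p \<Longrightarrow>
      (\<And>x K. (x, K) \<in> p \<Longrightarrow> x \<in> N) \<Longrightarrow> (\<Sum>(x, K)\<in>p. \<bar>f (Sup K) - f (Inf K)\<bar>) < \<epsilon>"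
proof -
  obtain U where U: "open U" "N \<subseteq> U"
    and variation: "\<And>p. p tagged_partial_division_of {a..b} \<Longrightarrow> (\<And>x K. (x, K) \<in> p \<Longrightarrow> K \<subseteq> U) \<Longrightarrow>
      (\<Sum>(x, K)\<in>p. \<bar>f (Sup K) - f (Inf K)\<bar>) < \<epsilon>"
    using abs_continuous_on_interval_small_variation_near_negligible[OF ac N \<open>0 < \<epsilon>\<close>] by blast
  have "\<exists>d>0. (x \<in> N \<longrightarrow> ball x d \<subseteq> U) \<and>
      (x \<in> {a..b} - N \<longrightarrow> (\<forall>u v. u \<le> x \<longrightarrow> x \<le> v \<longrightarrow> {u..v} \<subseteq> ball x d \<longrightarrow>
        \<bar>(v - u) * f' x - (f v - f u)\<bar> \<le> \<eta> * (v - u)))" for x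
  proof (cases "x \<in> N")
    case True
    then show ?thesis using U by (auto simp: open_contains_ball)
  next
    case False
    then show ?thesis
      using has_real_derivative_straddle[OF deriv \<open>0 < \<eta>\<close>, of x] by (metis DiffI zero_less_one)
  qed
  then obtain d where d: "\<And>x. 0 < d x" "\<And>x. x \<in> N \<Longrightarrow> ball x (d x) \<subseteq> U"
    "\<And>x u v. x \<in> {a..b} - N \<Longrightarrow> u \<le> x \<Longrightarrow> x \<le> v \<Longrightarrow> {u..v} \<subseteq> ball x (d x) \<Longrightarrow>
      \<bar>(v - u) * f' x - (f v - f u)\<bar> \<le> \<eta> * (v - u)"
    by metis
  show thesis
  proof (rule that[OF d(1,3)])
    fix p
    assume p: "p tagged_partial_division_of {a..b}" and fine: "(\<lambda>x. ball x (d x)) fine p"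
      and tags: "\<And>x K. (x, K) \<in> p \<Longrightarrow> x \<in> N"
    have "K \<subseteq> U" if "(x, K) \<in> p" for x K
      using fineD[OF fine that] d(2)[OF tags[OF that]] by blast
    then show "(\<Sum>(x, K)\<in>p. \<bar>f (Sup K) - f (Inf K)\<bar>) < \<epsilon>"
      using p variation by blast
  qed
qed

lemma abs_continuous_on_interval_Riemann_gauge:
  fixes f g :: "real \<Rightarrow> real"
  assumes "a \<le> b" and ac: "abs_continuous_on_interval a b f" and N: "negligible N"
    and deriv: "\<And>x. x \<in> {a..b} - N \<Longrightarrow> (f has_real_derivative g x) (at x)"
    and zero: "\<And>x. x \<in> N \<Longrightarrow> g x = 0" and "0 < \<epsilon>"
  obtains \<gamma> where "gauge \<gamma>"
    "\<And>p. p tagged_division_of {a..b} \<Longrightarrow> \<gamma> fine p \<Longrightarrow>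
      \<bar>(\<Sum>(x, K)\<in>p. measure lborel K * g x) - (f b - f a)\<bar> < \<epsilon>"
proof -
  define \<eta> where "\<eta> = \<epsilon> / (2 * (b - a + 1))"
  have "0 < \<eta>" and \<eta>: "\<eta> * (b - a) \<le> \<epsilon> / 2"
    using \<open>0 < \<epsilon>\<close> \<open>a \<le> b\<close> by (simp_all add: \<eta>_def field_simps)
  obtain d where d: "\<And>x. 0 < d x"
    and straddle: "\<And>x u v. x \<in> {a..b} - N \<Longrightarrow> u \<le> x \<Longrightarrow> x \<le> v \<Longrightarrow> {u..v} \<subseteq> ball x (d x) \<Longrightarrow>
      \<bar>(v - u) * g x - (f v - f u)\<bar> \<le> \<eta> * (v - u)"
    and variation: "\<And>p. p tagged_partial_division_of {a..b} \<Longrightarrow> (\<lambda>x. ball x (d x)) fine p \<Longrightarrow>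
      (\<And>x K. (x, K) \<in> p \<Longrightarrow> x \<in> N) \<Longrightarrow> (\<Sum>(x, K)\<in>p. \<bar>f (Sup K) - f (Inf K)\<bar>) < \<epsilon> / 2"
    using abs_continuous_on_interval_straddle_gauge
      [OF ac N deriv \<open>0 < \<eta>\<close> half_gt_zero[OF \<open>0 < \<epsilon>\<close>]] by blast
  show thesis
  proof (rule that)
    show "gauge (\<lambda>x. ball x (d x))"
      using d gauge_ball_dependent by blast
  next
    fix p assume p: "p tagged_division_of {a..b}" and fine: "(\<lambda>x. ball x (d x)) fine p"
    define q where "q = {(x, K). (x, K) \<in> p \<and> x \<in> N}"
    have "\<bar>(\<Sum>(x, K)\<in>p. measure lborel K * g x) - (f b - f a)\<bar>
        \<le> \<eta> * (b - a) + (\<Sum>(x, K)\<in>q. \<bar>f (Sup K) - f (Inf K)\<bar>)"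
      unfolding q_def using \<open>0 < \<eta>\<close> zero straddle
      by (intro Riemann_sum_straddle_error[OF \<open>a \<le> b\<close> _ p fine]) simp_all
    also have "(\<Sum>(x, K)\<in>q. \<bar>f (Sup K) - f (Inf K)\<bar>) < \<epsilon> / 2"
    proof (rule variation)
      show "q tagged_partial_division_of {a..b}"
        using p by (auto simp: q_def tagged_division_of_def intro: tagged_partial_division_subset)
      show "(\<lambda>x. ball x (d x)) fine q"
        using fine by (rule fine_subset[rotated]) (auto simp: q_def)
    qed (simp add: q_def)
    finally show "\<bar>(\<Sum>(x, K)\<in>p. measure lborel K * g x) - (f b - f a)\<bar> < \<epsilon>"
      using \<eta> by simp
  qed
qed

theorem fundamental_theorem_of_calculus_abs_continuous:
  fixes f f' :: "real \<Rightarrow> real"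
  assumes "a \<le> b" and ac: "abs_continuous_on_interval a b f" and N: "negligible N"
    and deriv: "\<And>x. x \<in> {a..b} - N \<Longrightarrow> (f has_real_derivative f' x) (at x)"
  shows "(f' has_integral (f b - f a)) {a..b}"
proof -
  define g where "g x = (if x \<in> N then 0 else f' x)" for x
  have deriv_g: "(f has_real_derivative g x) (at x)" if "x \<in> {a..b} - N" for x
    using deriv[OF that] that by (simp add: g_def)
  have "(g has_integral (f b - f a)) {a..b}"
    unfolding has_integral_real
  proof (intro allI impI)
    fix \<epsilon> :: real assume "0 < \<epsilon>"
    have zero: "g x = 0" if "x \<in> N" for x using that by (simp add: g_def)
    obtain \<gamma> where "gauge \<gamma>" and \<gamma>: "\<And>p. p tagged_division_of {a..b} \<Longrightarrow> \<gamma> fine p \<Longrightarrow>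
        \<bar>(\<Sum>(x, K)\<in>p. measure lborel K * g x) - (f b - f a)\<bar> < \<epsilon>"
      using abs_continuous_on_interval_Riemann_gauge
        [OF \<open>a \<le> b\<close> ac N deriv_g zero \<open>0 < \<epsilon>\<close>] by blast
    then show "\<exists>\<gamma>. gauge \<gamma> \<and> (\<forall>p. p tagged_division_of {a..b} \<and> \<gamma> fine p \<longrightarrow>
        norm ((\<Sum>(x, K)\<in>p. measure lborel K *\<^sub>R g x) - (f b - f a)) < \<epsilon>)"
      by (intro exI[of _ \<gamma>]) simp
  qed
  then show ?thesis
    by (rule has_integral_spike[OF N, rotated]) (simp add: g_def)
qed

lemma lipschitz_imp_abs_continuous_fun:
  fixes f :: "real \<Rightarrow> real"
  assumes "C-lipschitz_on UNIV f"
  shows "abs_continuous_fun f"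
  unfolding abs_continuous_fun_def abs_continuous_on_interval_def
proof (intro allI impI)
  fix a b \<epsilon> :: real assume "0 < \<epsilon>"
  have "0 \<le> C" using assms by (rule lipschitz_on_nonneg)
  have "(\<Sum>(x, y)\<in>P. \<bar>f y - f x\<bar>) < \<epsilon>"
    if P: "\<forall>(x, y)\<in>P. a \<le> x \<and> x \<le> y \<and> y \<le> b" and small: "(\<Sum>(x, y)\<in>P. y - x) < \<epsilon> / (C + 1)" for P
  proof -
    have "\<bar>f y - f x\<bar> \<le> C * (y - x)" if "x \<le> y" for x y
      using lipschitz_onD[OF assms, of y x] that by (simp add: dist_real_def)
    then have "(\<Sum>(x, y)\<in>P. \<bar>f y - f x\<bar>) \<le> (\<Sum>(x, y)\<in>P. C * (y - x))"
      using P by (intro sum_mono) auto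
    also have "\<dots> = C * (\<Sum>(x, y)\<in>P. y - x)"
      by (simp add: sum_distrib_left split_def)
    also have "\<dots> \<le> C * (\<epsilon> / (C + 1))"
      using small \<open>0 \<le> C\<close> by (intro mult_left_mono) simp_all
    also have "\<dots> < \<epsilon>"
      using \<open>0 \<le> C\<close> \<open>0 < \<epsilon>\<close> by (simp add: field_simps)
    finally show ?thesis .
  qed
  moreover have "0 < \<epsilon> / (C + 1)" using \<open>0 < \<epsilon>\<close> \<open>0 \<le> C\<close> by simp
  ultimately show "\<exists>\<delta>>0. \<forall>P. finite P \<and> (\<forall>(x, y)\<in>P. a \<le> x \<and> x \<le> y \<and> y \<le> b) \<and>
      pairwise (\<lambda>p q. disjnt {fst p<..<snd p} {fst q<..<snd q}) P \<and>
      (\<Sum>(x, y)\<in>P. y - x) < \<delta> \<longrightarrow> (\<Sum>(x, y)\<in>P. \<bar>f y - f x\<bar>) < \<epsilon>"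
    by blast
qed

section \<open>Existence and uniqueness of the zero bias distribution\<close>

lemma lipschitz_on_min_right: "1-lipschitz_on S (\<lambda>x. min x t)" for t :: real
  by (rule lipschitz_onI) (auto simp: dist_real_def)

lemma has_real_derivative_min_right:
  fixes x t :: real
  assumes "x \<noteq> t"
  shows "((\<lambda>x. min x t) has_real_derivative indicator {..t} x) (at x)"
proof (cases "x < t")
  case True
  have "((\<lambda>x. min x t) has_real_derivative 1) (at x)"
    by (rule has_field_derivative_transform_within_open[where f = "\<lambda>x. x" and S = "{..<t}"])
      (use True in auto)
  then show ?thesis using True by simp
next
  case False
  have "((\<lambda>x. min x t) has_real_derivative 0) (at x)"
    by (rule has_field_derivative_transform_within_open[where f = "\<lambda>x. t" and S = "{t<..}"])
      (use assms False in auto)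
  then show ?thesis using assms False by simp
qed

definition zero_bias_kernel :: "real \<Rightarrow> real \<Rightarrow> real" where
  "zero_bias_kernel x t = \<bar>x\<bar> * indicator (closed_segment 0 x) t"

lemma zero_bias_kernel_nonneg: "0 \<le> zero_bias_kernel x t"
  by (simp add: zero_bias_kernel_def)

lemma borel_measurable_zero_bias_kernel [measurable]:
  assumes [measurable]: "f \<in> borel_measurable M" "g \<in> borel_measurable M"
  shows "(\<lambda>w. zero_bias_kernel (f w) (g w)) \<in> borel_measurable M"
proof -
  have "zero_bias_kernel x t = (if min 0 x \<le> t \<and> t \<le> max 0 x then \<bar>x\<bar> else 0)" for x t
    by (simp add: zero_bias_kernel_def indicator_def closed_segment_eq_real_ivl)
  then show ?thesis by simp
qed

lemma nn_integral_zero_bias_kernel: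
  "(\<integral>\<^sup>+t. ennreal (zero_bias_kernel x t) \<partial>lborel) = ennreal (x\<^sup>2)"
proof -
  have "(\<integral>\<^sup>+t. ennreal (zero_bias_kernel x t) \<partial>lborel)
      = (\<integral>\<^sup>+t. ennreal \<bar>x\<bar> * indicator (closed_segment 0 x) t \<partial>lborel)"
    by (intro nn_integral_cong) (simp add: zero_bias_kernel_def indicator_def)
  also have "\<dots> = ennreal \<bar>x\<bar> * emeasure lborel (closed_segment 0 x)"
    by (simp add: nn_integral_cmult_indicator)
  also have "\<dots> = ennreal (x\<^sup>2)"
    by (simp add: closed_segment_eq_real_ivl ennreal_mult[symmetric] power2_eq_square)
  finally show ?thesis .
qed

lemma integral_zero_bias_kernel_deriv:
  assumes f: "abs_continuous_fun f" "AE t in lborel. (f has_real_derivative f' t) (at t)"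
    and integrable: "integrable lborel (\<lambda>t. zero_bias_kernel x t * f' t)"
  shows "(\<integral>t. zero_bias_kernel x t * f' t \<partial>lborel) = x * (f x - f 0)"
proof (cases "x = 0")
  case False
  define a b where "a = min 0 x" and "b = max 0 x"
  have kernel: "zero_bias_kernel x t * f' t = \<bar>x\<bar> * (indicator {a..b} t *\<^sub>R f' t)" for t
    by (simp add: zero_bias_kernel_def a_def b_def closed_segment_eq_real_ivl)
  obtain N where N: "N \<in> null_sets lborel" "{t. \<not> (f has_real_derivative f' t) (at t)} \<subseteq> N"
    using f(2) by (auto simp: eventually_ae_filter)
  have "(f' has_integral (f b - f a)) {a..b}"
  proof (rule fundamental_theorem_of_calculus_abs_continuous)
    show "a \<le> b" by (simp add: a_def b_def)
    then show "abs_continuous_on_interval a b f"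
      using f(1) by (simp add: abs_continuous_fun_def)
    show "negligible N"
      using N(1) by (simp add: negligible_iff_null_sets null_sets_completionI)
  qed (use N(2) in auto)
  then have "integral {a..b} f' = f b - f a" by (rule integral_unique)
  moreover have "set_integrable lborel {a..b} f'"
    using integrable False unfolding kernel set_integrable_def by simp
  ultimately have "(LINT t:{a..b}|lborel. f' t) = f b - f a"
    using set_borel_integral_eq_integral(2) by metis
  then have "(\<integral>t. zero_bias_kernel x t * f' t \<partial>lborel) = \<bar>x\<bar> * (f b - f a)"
    unfolding kernel set_lebesgue_integral_def by simp
  also have "\<dots> = x * (f x - f 0)"
    by (auto simp: a_def b_def min_def max_def algebra_simps)
  finally show ?thesis .
qed (simp add: zero_bias_kernel_def)

locale centered_distribution = real_distribution G for G +
  assumes integrable_square: "integrable G (\<lambda>x. x\<^sup>2)"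
    and dist_mean_zero: "dist_mean G = 0"
    and dist_variance_pos: "0 < dist_variance G"
begin

lemma integrable_id: "integrable G (\<lambda>x. x)"
  by (rule square_integrable_imp_integrable[OF _ integrable_square]) simp

lemma expectation_id: "(\<integral>x. x \<partial>G) = 0"
  using dist_mean_zero by (simp add: dist_mean_def)

lemma expectation_square: "(\<integral>x. x\<^sup>2 \<partial>G) = dist_variance G"
  by (simp add: dist_variance_def dist_mean_zero)

lemma integrable_mult_min: "integrable G (\<lambda>x. x * min x t)"
proof (rule Bochner_Integration.integrable_bound)
  show "integrable G (\<lambda>x. x\<^sup>2 + \<bar>t\<bar> * \<bar>x\<bar>)"
    using integrable_id integrable_square by auto
  have "\<bar>x * min x t\<bar> \<le> x\<^sup>2 + \<bar>t\<bar> * \<bar>x\<bar>" for x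
    by (auto simp: min_def abs_mult power2_eq_square)
  then show "AE x in G. norm (x * min x t) \<le> norm (x\<^sup>2 + \<bar>t\<bar> * \<bar>x\<bar>)"
    by (auto intro: order.trans)
qed auto

lemma variance_mult_cdf_is_zero_bias:
  assumes "is_zero_bias G N"
  shows "dist_variance G * cdf N t = (\<integral>x. x * min x t \<partial>G)"
proof -
  interpret N: real_distribution N using assms by (simp add: is_zero_bias_def)
  have "abs_continuous_fun (\<lambda>x. min x t)"
    by (rule lipschitz_imp_abs_continuous_fun[OF lipschitz_on_min_right])
  moreover have "AE x in lborel. ((\<lambda>x. min x t) has_real_derivative indicator {..t} x) (at x)"
    using AE_lborel_singleton[of t] by eventually_elim (rule has_real_derivative_min_right)
  moreover have "integrable N (indicator {..t} :: real \<Rightarrow> real)"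
    by (intro integrable_real_indicator) (auto simp: N.emeasure_finite less_top[symmetric])
  ultimately have "dist_variance G * (\<integral>x. indicator {..t} x \<partial>N) = (\<integral>x. x * min x t \<partial>G)"
    using assms integrable_mult_min unfolding is_zero_bias_def by blast
  then show ?thesis by (simp add: cdf_def)
qed

lemma is_zero_bias_unique:
  assumes "is_zero_bias G N" "is_zero_bias G N'"
  shows "N = N'"
proof (rule cdf_unique)
  show "cdf N = cdf N'"
  proof
    fix t
    have "dist_variance G * cdf N t = dist_variance G * cdf N' t"
      using assms by (simp add: variance_mult_cdf_is_zero_bias)
    then show "cdf N t = cdf N' t" using dist_variance_pos by simp
  qed
qed (use assms in \<open>auto simp: is_zero_bias_def\<close>)

text \<open>The first coordinate has the law of \<open>X\<close> reweighted by \<open>x\<^sup>2 / \<sigma>\<^sup>2\<close>; given that it equals \<open>x\<close>,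
  the second coordinate is uniform between \<open>0\<close> and \<open>x\<close>.\<close>

definition zero_bias_coupling :: "(real \<times> real) measure" where
  "zero_bias_coupling =
    density (G \<Otimes>\<^sub>M lborel) (\<lambda>(x, t). ennreal (zero_bias_kernel x t / dist_variance G))"

lemma sets_zero_bias_coupling [measurable_cong, simp]:
  "sets zero_bias_coupling = sets (borel \<Otimes>\<^sub>M borel)"
  unfolding zero_bias_coupling_def sets_density by (intro sets_pair_measure_cong) auto

lemma prob_space_zero_bias_coupling: "prob_space zero_bias_coupling"
proof (rule prob_spaceI)
  have "emeasure zero_bias_coupling (space zero_bias_coupling)
      = (\<integral>\<^sup>+(x, t). ennreal (zero_bias_kernel x t / dist_variance G) \<partial>(G \<Otimes>\<^sub>M lborel))"
    unfolding zero_bias_coupling_def space_density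
    by (subst emeasure_density[OF _ sets.top]) (auto intro!: nn_integral_cong)
  also have "\<dots> = (\<integral>\<^sup>+x. \<integral>\<^sup>+t. ennreal (zero_bias_kernel x t / dist_variance G) \<partial>lborel \<partial>G)"
    by (subst lborel.nn_integral_fst[symmetric]) auto
  also have "\<dots> = (\<integral>\<^sup>+x. ennreal (x\<^sup>2 / dist_variance G) \<partial>G)"
    using dist_variance_pos
    by (simp add: divide_ennreal[symmetric] zero_bias_kernel_nonneg nn_integral_divide
        nn_integral_zero_bias_kernel)
  also have "\<dots> = ennreal (\<integral>x. x\<^sup>2 / dist_variance G \<partial>G)"
    using integrable_square dist_variance_pos by (intro nn_integral_eq_integral) auto
  also have "\<dots> = 1"
    using dist_variance_pos by (simp add: expectation_square)
  finally show "emeasure zero_bias_coupling (space zero_bias_coupling) = 1" .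
qed

lemma
  fixes h :: "real \<times> real \<Rightarrow> real"
  assumes [measurable]: "h \<in> borel_measurable (borel \<Otimes>\<^sub>M borel)"
  shows integrable_zero_bias_coupling_iff: "integrable zero_bias_coupling h \<longleftrightarrow>
      integrable (G \<Otimes>\<^sub>M lborel) (\<lambda>(x, t). zero_bias_kernel x t * h (x, t))"
    and variance_mult_integral_zero_bias_coupling: "dist_variance G * (\<integral>p. h p \<partial>zero_bias_coupling)
      = (\<integral>(x, t). zero_bias_kernel x t * h (x, t) \<partial>(G \<Otimes>\<^sub>M lborel))"
proof -
  have coupling: "zero_bias_coupling = density (G \<Otimes>\<^sub>M lborel)
      (\<lambda>p. ennreal (inverse (dist_variance G) * zero_bias_kernel (fst p) (snd p)))"
    by (simp add: zero_bias_coupling_def split_def divide_inverse mult.commute)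
  show "integrable zero_bias_coupling h \<longleftrightarrow>
      integrable (G \<Otimes>\<^sub>M lborel) (\<lambda>(x, t). zero_bias_kernel x t * h (x, t))"
    using dist_variance_pos unfolding coupling
    by (subst integrable_density) (auto simp: zero_bias_kernel_nonneg split_def mult.assoc)
  show "dist_variance G * (\<integral>p. h p \<partial>zero_bias_coupling)
      = (\<integral>(x, t). zero_bias_kernel x t * h (x, t) \<partial>(G \<Otimes>\<^sub>M lborel))"
    using dist_variance_pos unfolding coupling
    by (subst integral_density) (auto simp: zero_bias_kernel_nonneg split_def mult.assoc)
qed

lemma integral_zero_bias_coupling_deriv:
  assumes f: "abs_continuous_fun f" "AE t in lborel. (f has_real_derivative f' t) (at t)"
    and f': "f' \<in> borel_measurable borel" "integrable zero_bias_coupling (\<lambda>p. f' (snd p))"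
    and xf: "integrable G (\<lambda>x. x * f x)"
  shows "dist_variance G * (\<integral>p. f' (snd p) \<partial>zero_bias_coupling) = (\<integral>x. x * f x \<partial>G)"
proof -
  interpret pair_sigma_finite G lborel ..
  note [measurable] = f'(1)
  have kernel: "integrable (G \<Otimes>\<^sub>M lborel) (\<lambda>(x, t). zero_bias_kernel x t * f' t)"
    using f'(2) by (simp add: integrable_zero_bias_coupling_iff)
  have "dist_variance G * (\<integral>p. f' (snd p) \<partial>zero_bias_coupling)
      = (\<integral>(x, t). zero_bias_kernel x t * f' t \<partial>(G \<Otimes>\<^sub>M lborel))"
    by (simp add: variance_mult_integral_zero_bias_coupling)
  also have "\<dots> = (\<integral>x. \<integral>t. zero_bias_kernel x t * f' t \<partial>lborel \<partial>G)"
    by (rule integral_fst'[OF kernel, symmetric, simplified])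
  also have "\<dots> = (\<integral>x. x * (f x - f 0) \<partial>G)"
  proof (rule integral_cong_AE)
    show "AE x in G. (\<integral>t. zero_bias_kernel x t * f' t \<partial>lborel) = x * (f x - f 0)"
      using AE_integrable_fst[OF kernel]
      by eventually_elim (rule integral_zero_bias_kernel_deriv[OF f])
  qed (use integrable_fst[OF kernel] xf in \<open>auto simp: right_diff_distrib integrable_id\<close>)
  also have "\<dots> = (\<integral>x. x * f x \<partial>G)"
    using xf integrable_id by (simp add: right_diff_distrib expectation_id)
  finally show ?thesis .
qed

lemma is_zero_bias_distr_coupling: "is_zero_bias G (distr zero_bias_coupling borel snd)"
  unfolding is_zero_bias_def
proof (intro conjI allI impI)
  interpret coupling: prob_space zero_bias_coupling by (rule prob_space_zero_bias_coupling)
  show "real_distribution (distr zero_bias_coupling borel snd)" by simp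
  fix f f' :: "real \<Rightarrow> real"
  assume f: "abs_continuous_fun f" "AE x in lborel. (f has_real_derivative f' x) (at x)"
    and f': "integrable (distr zero_bias_coupling borel snd) f'"
    and xf: "integrable G (\<lambda>x. x * f x)"
  have [measurable]: "f' \<in> borel_measurable borel"
    using borel_measurable_integrable[OF f'] by simp
  have "integrable zero_bias_coupling (\<lambda>p. f' (snd p))"
    using f' by (subst (asm) integrable_distr_eq) auto
  from integral_zero_bias_coupling_deriv[OF f _ this xf]
  show "dist_variance G * (\<integral>x. f' x \<partial>distr zero_bias_coupling borel snd) = (\<integral>x. x * f x \<partial>G)"
    by (simp add: integral_distr)
qed

lemma is_zero_bias_zero_bias: "is_zero_bias G (zero_bias G)"
proof -
  have "\<exists>!N. is_zero_bias G N"
    using is_zero_bias_distr_coupling is_zero_bias_unique by blast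
  then show ?thesis unfolding zero_bias_def by (rule theI')
qed

lemma variance_mult_cdf_zero_bias: "dist_variance G * cdf (zero_bias G) t = (\<integral>x. x * min x t \<partial>G)"
  by (rule variance_mult_cdf_is_zero_bias[OF is_zero_bias_zero_bias])

end

section \<open>Symmetrisation and the upper bound\<close>

lemma (in prob_space)
  fixes f g :: "'a \<Rightarrow> real"
  assumes f: "integrable M f" and g: "integrable M g" and fg: "integrable M (\<lambda>x. f x * g x)"
  shows integrable_diff_mult_diff: "integrable M (\<lambda>y. (f x - f y) * (g x - g y))"
    and integrable_expectation_diff_mult_diff:
      "integrable M (\<lambda>x. \<integral>y. (f x - f y) * (g x - g y) \<partial>M)"
    and expectation_diff_mult_diff:
      "(\<integral>x. \<integral>y. (f x - f y) * (g x - g y) \<partial>M \<partial>M)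
        = 2 * ((\<integral>x. f x * g x \<partial>M) - (\<integral>x. f x \<partial>M) * (\<integral>x. g x \<partial>M))"
proof -
  have expand: "(f x - f y) * (g x - g y) = f x * g x - f x * g y - g x * f y + f y * g y" for x y
    by (simp add: algebra_simps)
  show "integrable M (\<lambda>y. (f x - f y) * (g x - g y))" for x
    unfolding expand using f g fg by simp
  have inner: "(\<integral>y. (f x - f y) * (g x - g y) \<partial>M)
      = f x * g x - f x * (\<integral>y. g y \<partial>M) - g x * (\<integral>y. f y \<partial>M) + (\<integral>y. f y * g y \<partial>M)" for x
    unfolding expand using f g fg prob_space by simp
  show "integrable M (\<lambda>x. \<integral>y. (f x - f y) * (g x - g y) \<partial>M)"
    unfolding inner using f g fg by simp
  show "(\<integral>x. \<integral>y. (f x - f y) * (g x - g y) \<partial>M \<partial>M)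
      = 2 * ((\<integral>x. f x * g x \<partial>M) - (\<integral>x. f x \<partial>M) * (\<integral>x. g x \<partial>M))"
    unfolding inner using f g fg prob_space by simp
qed

lemma (in prob_space) nn_integral_diff_mult_diff:
  fixes f g :: "'a \<Rightarrow> real"
  assumes integrable: "integrable M f" "integrable M g" "integrable M (\<lambda>x. f x * g x)"
    and nonneg: "\<And>x y. 0 \<le> (f x - f y) * (g x - g y)"
  shows "(\<integral>\<^sup>+x. \<integral>\<^sup>+y. ennreal ((f x - f y) * (g x - g y)) \<partial>M \<partial>M)
    = ennreal (2 * ((\<integral>x. f x * g x \<partial>M) - (\<integral>x. f x \<partial>M) * (\<integral>x. g x \<partial>M)))"
proof -
  have "(\<integral>\<^sup>+x. \<integral>\<^sup>+y. ennreal ((f x - f y) * (g x - g y)) \<partial>M \<partial>M)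
      = (\<integral>\<^sup>+x. ennreal (\<integral>y. (f x - f y) * (g x - g y) \<partial>M) \<partial>M)"
    using integrable_diff_mult_diff[OF integrable] nonneg
    by (intro nn_integral_cong nn_integral_eq_integral) auto
  also have "\<dots> = ennreal (\<integral>x. \<integral>y. (f x - f y) * (g x - g y) \<partial>M \<partial>M)"
    using integrable_expectation_diff_mult_diff[OF integrable] nonneg
    by (intro nn_integral_eq_integral) (auto intro: integral_nonneg_AE)
  finally show ?thesis by (simp only: expectation_diff_mult_diff[OF integrable])
qed

lemma DERIV_half_mult_abs: "((\<lambda>x::real. x * \<bar>x\<bar> / 2) has_real_derivative \<bar>x\<bar>) (at x)"
proof (cases "x = 0")
  case True
  have "((\<lambda>h::real. \<bar>h\<bar> / 2) \<longlongrightarrow> 0) (at 0)"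
    by (rule tendsto_eq_intros refl | simp)+
  then have "((\<lambda>h::real. h * \<bar>h\<bar> / 2 / h) \<longlongrightarrow> 0) (at 0)"
    by (rule Lim_transform_eventually) (auto simp: eventually_at_filter)
  then show ?thesis using True by (simp add: DERIV_def)
next
  case False
  have "((\<lambda>y. sgn x * y\<^sup>2 / 2) has_real_derivative \<bar>x\<bar>) (at x)"
    by (auto intro!: derivative_eq_intros simp: abs_sgn mult.commute)
  then show ?thesis
    by (rule has_field_derivative_transform_within[where d = "\<bar>x\<bar>"])
      (use False in \<open>auto simp: dist_real_def sgn_if power2_eq_square abs_if split: if_splits\<close>)
qed

lemma mono_half_mult_abs: "mono (\<lambda>x::real. x * \<bar>x\<bar> / 2)"
proof (rule monoI)
  fix x y :: real assume "x \<le> y"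
  then show "x * \<bar>x\<bar> / 2 \<le> y * \<bar>y\<bar> / 2"
    by (rule DERIV_nonneg_imp_nondecreasing) (use DERIV_half_mult_abs abs_ge_zero in blast)
qed

lemma nn_integral_abs_reflected:
  assumes "a \<le> b"
  shows "(\<integral>\<^sup>+t. ennreal \<bar>a + b - t\<bar> * indicator {a..b} t \<partial>lborel)
    = ennreal (b * \<bar>b\<bar> / 2 - a * \<bar>a\<bar> / 2)"
proof -
  have "((\<lambda>t. - ((a + b - t) * \<bar>a + b - t\<bar> / 2)) has_real_derivative \<bar>a + b - t\<bar>) (at t)" for t
  proof -
    have "((\<lambda>t. a + b - t) has_real_derivative -1) (at t)"
      by (auto intro!: derivative_eq_intros)
    from DERIV_minus[OF DERIV_chain'[OF this DERIV_half_mult_abs]] show ?thesis by simp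
  qed
  then have "(\<integral>\<^sup>+t. ennreal \<bar>a + b - t\<bar> * indicator {a..b} t \<partial>lborel)
      = ennreal (- ((a + b - b) * \<bar>a + b - b\<bar> / 2) - - ((a + b - a) * \<bar>a + b - a\<bar> / 2))"
    using assms by (intro nn_integral_FTC_Icc) auto
  then show ?thesis by simp
qed

definition cdf_gap_kernel :: "real \<Rightarrow> real \<Rightarrow> real \<Rightarrow> real" where
  "cdf_gap_kernel x y t =
    ((x\<^sup>2 - t * x) - (y\<^sup>2 - t * y)) * (indicator {..t} x - indicator {..t} y)"

lemma cdf_gap_kernel_commute: "cdf_gap_kernel x y t = cdf_gap_kernel y x t"
  by (simp add: cdf_gap_kernel_def algebra_simps)

lemma borel_measurable_cdf_gap_kernel [measurable]:
  assumes [measurable]: "f \<in> borel_measurable M" "g \<in> borel_measurable M" "h \<in> borel_measurable M"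
  shows "(\<lambda>w. cdf_gap_kernel (f w) (g w) (h w)) \<in> borel_measurable M"
proof -
  have "cdf_gap_kernel x y t = ((x\<^sup>2 - t * x) - (y\<^sup>2 - t * y)) *
      ((if x \<le> t then 1 else 0) - (if y \<le> t then 1 else 0))" for x y t
    by (simp add: cdf_gap_kernel_def indicator_def)
  then show ?thesis by simp
qed

lemma abs_cdf_gap_kernel:
  assumes "x \<le> y" "t \<noteq> y"
  shows "\<bar>cdf_gap_kernel x y t\<bar> = (y - x) * (\<bar>x + y - t\<bar> * indicator {x..y} t)"
proof -
  have "(x\<^sup>2 - t * x) - (y\<^sup>2 - t * y) = - ((y - x) * (x + y - t))"
    by (simp add: algebra_simps power2_eq_square)
  moreover have "indicator {..t} x - indicator {..t} y = (indicator {x..y} t :: real)"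
    using assms by (auto simp: indicator_def)
  ultimately show ?thesis
    using assms(1) by (simp add: cdf_gap_kernel_def abs_mult)
qed

lemma nn_integral_abs_cdf_gap_kernel:
  "(\<integral>\<^sup>+t. ennreal \<bar>cdf_gap_kernel x y t\<bar> \<partial>lborel)
    = ennreal ((x - y) * (x * \<bar>x\<bar> / 2 - y * \<bar>y\<bar> / 2))"
proof (induction x y rule: linorder_wlog)
  case (le x y)
  have "(\<integral>\<^sup>+t. ennreal \<bar>cdf_gap_kernel x y t\<bar> \<partial>lborel)
      = (\<integral>\<^sup>+t. ennreal (y - x) * (ennreal \<bar>x + y - t\<bar> * indicator {x..y} t) \<partial>lborel)"
  proof (rule nn_integral_cong_AE)
    show "AE t in lborel. ennreal \<bar>cdf_gap_kernel x y t\<bar>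
        = ennreal (y - x) * (ennreal \<bar>x + y - t\<bar> * indicator {x..y} t)"
      using AE_lborel_singleton[of y]
      by eventually_elim
        (use le in \<open>simp add: abs_cdf_gap_kernel ennreal_mult' indicator_def\<close>)
  qed
  also have "\<dots> = ennreal (y - x) * ennreal (y * \<bar>y\<bar> / 2 - x * \<bar>x\<bar> / 2)"
    using le by (simp add: nn_integral_cmult nn_integral_abs_reflected)
  also have "\<dots> = ennreal ((x - y) * (x * \<bar>x\<bar> / 2 - y * \<bar>y\<bar> / 2))"
    using le by (subst ennreal_mult'[symmetric]) (auto simp: field_simps)
  finally show ?case .
next
  case (sym x y)
  then show ?case by (simp add: cdf_gap_kernel_commute[of y x] field_simps)
qed

lemma (in finite_borel_measure) borel_measurable_cdf [measurable]: "cdf M \<in> borel_measurable borel"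
  by (intro borel_measurable_mono monoI cdf_nondecreasing)

context centered_distribution
begin

lemma
  shows integrable_cdf_gap_kernel: "integrable G (\<lambda>y. cdf_gap_kernel x y t)"
    and integrable_expectation_cdf_gap_kernel:
      "integrable G (\<lambda>x. \<integral>y. cdf_gap_kernel x y t \<partial>G)"
    and expectation_cdf_gap_kernel: "(\<integral>x. \<integral>y. cdf_gap_kernel x y t \<partial>G \<partial>G)
      = 2 * dist_variance G * (cdf (zero_bias G) t - cdf G t)"
proof -
  define q where "q = (\<lambda>x::real. x\<^sup>2 - t * x)"
  define I :: "real \<Rightarrow> real" where "I = indicator {..t}"
  have kernel: "cdf_gap_kernel x y t = (q x - q y) * (I x - I y)" for x y
    by (simp add: cdf_gap_kernel_def q_def I_def)
  have q: "integrable G q" "(\<integral>x. q x \<partial>G) = dist_variance G"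
    using integrable_id integrable_square
    by (simp_all add: q_def expectation_id expectation_square)
  have I: "integrable G I" "(\<integral>x. I x \<partial>G) = cdf G t"
    by (auto simp: I_def cdf_def less_top[symmetric] intro!: integrable_real_indicator)
  have qI: "q x * I x = x * min x t - t * x" for x
    by (simp add: q_def I_def indicator_def algebra_simps power2_eq_square)
  have integrable_qI: "integrable G (\<lambda>x. q x * I x)"
    unfolding qI using integrable_mult_min integrable_id by simp
  have "(\<integral>x. q x * I x \<partial>G) = dist_variance G * cdf (zero_bias G) t"
    unfolding qI using integrable_mult_min integrable_id
    by (simp add: expectation_id variance_mult_cdf_zero_bias)
  then show "(\<integral>x. \<integral>y. cdf_gap_kernel x y t \<partial>G \<partial>G)
      = 2 * dist_variance G * (cdf (zero_bias G) t - cdf G t)"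
    unfolding kernel expectation_diff_mult_diff[OF q(1) I(1) integrable_qI]
    by (simp add: q I right_diff_distrib)
  show "integrable G (\<lambda>y. cdf_gap_kernel x y t)" for x
    unfolding kernel by (rule integrable_diff_mult_diff[OF q(1) I(1) integrable_qI])
  show "integrable G (\<lambda>x. \<integral>y. cdf_gap_kernel x y t \<partial>G)"
    unfolding kernel by (rule integrable_expectation_diff_mult_diff[OF q(1) I(1) integrable_qI])
qed

lemma variance_mult_L1_dist_zero_bias:
  "ennreal (2 * dist_variance G) * L1_dist (cdf (zero_bias G)) (cdf G)
    = (\<integral>\<^sup>+t. ennreal \<bar>\<integral>x. \<integral>y. cdf_gap_kernel x y t \<partial>G \<partial>G\<bar> \<partial>lborel)"
proof -
  interpret zero_bias: real_distribution "zero_bias G"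
    using is_zero_bias_zero_bias by (simp add: is_zero_bias_def)
  have "ennreal (2 * dist_variance G) * L1_dist (cdf (zero_bias G)) (cdf G)
      = (\<integral>\<^sup>+t. ennreal (2 * dist_variance G) * ennreal \<bar>cdf (zero_bias G) t - cdf G t\<bar> \<partial>lborel)"
    unfolding L1_dist_def by (rule nn_integral_cmult[symmetric]) simp
  then show ?thesis
    unfolding expectation_cdf_gap_kernel using dist_variance_pos
    by (simp add: abs_mult ennreal_mult)
qed

lemma abs_expectation_cdf_gap_kernel_le:
  "ennreal \<bar>\<integral>x. \<integral>y. cdf_gap_kernel x y t \<partial>G \<partial>G\<bar>
    \<le> (\<integral>\<^sup>+x. \<integral>\<^sup>+y. ennreal \<bar>cdf_gap_kernel x y t\<bar> \<partial>G \<partial>G)"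
proof -
  have "ennreal \<bar>\<integral>x. \<integral>y. cdf_gap_kernel x y t \<partial>G \<partial>G\<bar>
      \<le> (\<integral>\<^sup>+x. ennreal \<bar>\<integral>y. cdf_gap_kernel x y t \<partial>G\<bar> \<partial>G)"
    using integral_norm_bound_ennreal[OF integrable_expectation_cdf_gap_kernel] by simp
  also have "\<dots> \<le> (\<integral>\<^sup>+x. \<integral>\<^sup>+y. ennreal \<bar>cdf_gap_kernel x y t\<bar> \<partial>G \<partial>G)"
    using integral_norm_bound_ennreal[OF integrable_cdf_gap_kernel]
    by (intro nn_integral_mono) simp
  finally show ?thesis .
qed

lemma nn_integral_abs_cdf_gap_kernel_eq_third_moment:
  assumes third: "integrable G (\<lambda>x. \<bar>x\<bar> ^ 3)"
  shows "(\<integral>\<^sup>+x. \<integral>\<^sup>+y. \<integral>\<^sup>+t. ennreal \<bar>cdf_gap_kernel x y t\<bar> \<partial>lborel \<partial>G \<partial>G)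
    = ennreal (abs_third_moment G)"
proof -
  have cube: "x * (x * \<bar>x\<bar>) = \<bar>x\<bar> ^ 3" for x :: real
    by (simp add: power3_eq_cube abs_if)
  have "integrable G (\<lambda>x. x * \<bar>x\<bar> / 2)"
    by (rule Bochner_Integration.integrable_bound[OF integrable_square])
      (auto simp: abs_mult power2_eq_square)
  moreover have "integrable G (\<lambda>x. x * (x * \<bar>x\<bar> / 2))"
    using third by (simp add: cube)
  moreover have "0 \<le> (x - y) * (x * \<bar>x\<bar> / 2 - y * \<bar>y\<bar> / 2)" for x y :: real
    using monoD[OF mono_half_mult_abs, of x y] monoD[OF mono_half_mult_abs, of y x]
    by (cases "x \<le> y") (auto simp: zero_le_mult_iff)
  ultimately show ?thesis
    unfolding nn_integral_abs_cdf_gap_kernel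
    by (subst nn_integral_diff_mult_diff[OF integrable_id])
      (simp_all add: cube expectation_id abs_third_moment_def)
qed

lemma variance_mult_L1_dist_zero_bias_le:
  assumes "integrable G (\<lambda>x. \<bar>x\<bar> ^ 3)"
  shows "ennreal (2 * dist_variance G) * L1_dist (cdf (zero_bias G)) (cdf G)
    \<le> ennreal (abs_third_moment G)"
proof -
  interpret pair_sigma_finite G lborel ..
  have "ennreal (2 * dist_variance G) * L1_dist (cdf (zero_bias G)) (cdf G)
      \<le> (\<integral>\<^sup>+t. \<integral>\<^sup>+x. \<integral>\<^sup>+y. ennreal \<bar>cdf_gap_kernel x y t\<bar> \<partial>G \<partial>G \<partial>lborel)"
    unfolding variance_mult_L1_dist_zero_bias
    by (intro nn_integral_mono abs_expectation_cdf_gap_kernel_le)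
  also have "\<dots> = (\<integral>\<^sup>+x. \<integral>\<^sup>+t. \<integral>\<^sup>+y. ennreal \<bar>cdf_gap_kernel x y t\<bar> \<partial>G \<partial>lborel \<partial>G)"
    by (rule Fubini') measurable
  also have "\<dots> = (\<integral>\<^sup>+x. \<integral>\<^sup>+y. \<integral>\<^sup>+t. ennreal \<bar>cdf_gap_kernel x y t\<bar> \<partial>lborel \<partial>G \<partial>G)"
    by (intro nn_integral_cong Fubini') measurable
  also have "\<dots> = ennreal (abs_third_moment G)"
    using assms by (rule nn_integral_abs_cdf_gap_kernel_eq_third_moment)
  finally show ?thesis .
qed

lemma abs_third_moment_pos:
  assumes "integrable G (\<lambda>x. \<bar>x\<bar> ^ 3)"
  shows "0 < abs_third_moment G"
proof (rule ccontr)
  assume "\<not> 0 < abs_third_moment G"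
  moreover have "0 \<le> abs_third_moment G"
    unfolding abs_third_moment_def by (intro integral_nonneg_AE) auto
  ultimately have "(\<integral>x. \<bar>x\<bar> ^ 3 \<partial>G) = 0"
    unfolding abs_third_moment_def by linarith
  then have "AE x in G. \<bar>x\<bar> ^ 3 = 0"
    using assms by (subst (asm) integral_nonneg_eq_0_iff_AE) auto
  then have "AE x in G. x\<^sup>2 = 0" by eventually_elim simp
  then have "(\<integral>x. x\<^sup>2 \<partial>G) = 0" by (rule integral_eq_zero_AE)
  then show False using dist_variance_pos by (simp add: expectation_square)
qed

lemma B_functional_le_1:
  assumes "integrable G (\<lambda>x. \<bar>x\<bar> ^ 3)"
  shows "B_functional G \<le> 1"
  unfolding B_functional_def
  using abs_third_moment_pos[OF assms] variance_mult_L1_dist_zero_bias_le[OF assms]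
  by (intro divide_le_posI_ennreal) auto

end

section \<open>The extremal distribution\<close>

lemma centered_distribution_F_class:
  assumes "0 < \<sigma>" "G \<in> F_class \<sigma>"
  shows "centered_distribution G"
  using assms by (simp add: F_class_def centered_distribution_def centered_distribution_axioms_def)

definition scaled_rademacher :: "real \<Rightarrow> real measure" where
  "scaled_rademacher \<sigma> =
    distr (measure_pmf (bernoulli_pmf (1 / 2))) borel (\<lambda>b. if b then \<sigma> else - \<sigma>)"

lemma integrable_scaled_rademacher:
  fixes f :: "real \<Rightarrow> real"
  assumes [measurable]: "f \<in> borel_measurable borel"
  shows "integrable (scaled_rademacher \<sigma>) f"
  unfolding scaled_rademacher_def
  by (simp add: integrable_distr_eq integrable_measure_pmf_finite)

lemma integral_scaled_rademacher:
  fixes f :: "real \<Rightarrow> real"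
  assumes [measurable]: "f \<in> borel_measurable borel"
  shows "(\<integral>x. f x \<partial>scaled_rademacher \<sigma>) = (f \<sigma> + f (- \<sigma>)) / 2"
  unfolding scaled_rademacher_def by (simp add: integral_distr field_simps)

lemma scaled_rademacher_in_F_class: "scaled_rademacher \<sigma> \<in> F_class \<sigma>"
proof -
  have "real_distribution (scaled_rademacher \<sigma>)"
    unfolding scaled_rademacher_def
    by (rule prob_space.real_distribution_distr[OF prob_space_measure_pmf]) simp
  moreover have "dist_mean (scaled_rademacher \<sigma>) = 0"
    by (simp add: dist_mean_def integral_scaled_rademacher)
  ultimately show ?thesis
    by (simp add: F_class_def dist_variance_def integrable_scaled_rademacher
        integral_scaled_rademacher)
qed

lemma B_functional_scaled_rademacher:
  assumes "0 < \<sigma>"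
  shows "B_functional (scaled_rademacher \<sigma>) = 1"
proof -
  let ?G = "scaled_rademacher \<sigma>"
  interpret centered_distribution ?G
    using assms scaled_rademacher_in_F_class by (rule centered_distribution_F_class)
  have third: "abs_third_moment ?G = \<sigma> ^ 3"
    using assms by (simp add: abs_third_moment_def integral_scaled_rademacher)
  have gap: "(\<integral>x. \<integral>y. cdf_gap_kernel x y t \<partial>?G \<partial>?G) = cdf_gap_kernel \<sigma> (- \<sigma>) t / 2" for t
  proof -
    have "cdf_gap_kernel x x t = 0" for x by (simp add: cdf_gap_kernel_def)
    then show ?thesis
      by (simp add: integral_scaled_rademacher cdf_gap_kernel_commute[of "- \<sigma>" \<sigma>])
  qed
  have "ennreal (2 * dist_variance ?G) * L1_dist (cdf (zero_bias ?G)) (cdf ?G)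
      = (\<integral>\<^sup>+t. ennreal \<bar>cdf_gap_kernel \<sigma> (- \<sigma>) t\<bar> / 2 \<partial>lborel)"
    unfolding variance_mult_L1_dist_zero_bias gap by (simp add: ennreal_divide_numeral)
  also have "\<dots> = ennreal ((\<sigma> - - \<sigma>) * (\<sigma> * \<bar>\<sigma>\<bar> / 2 - - \<sigma> * \<bar>- \<sigma>\<bar> / 2)) / 2"
    by (subst nn_integral_divide) (measurable, simp only: nn_integral_abs_cdf_gap_kernel)
  also have "\<dots> = ennreal (\<sigma> ^ 3)"
    using assms by (simp add: ennreal_divide_numeral power3_eq_cube)
  finally show ?thesis
    using assms by (simp add: B_functional_def third divide_ennreal)
qed

theorem lemma1p1:
  fixes \<sigma> :: real
  assumes "0 < \<sigma>"
  shows "B_collection (F_class \<sigma>) = 1"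
  unfolding B_collection_def
proof (rule antisym)
  show "(SUP G\<in>F_class \<sigma>. B_functional G) \<le> 1"
  proof (rule SUP_least)
    fix G assume G: "G \<in> F_class \<sigma>"
    then interpret centered_distribution G
      using assms by (intro centered_distribution_F_class)
    show "B_functional G \<le> 1"
      using G by (intro B_functional_le_1) (simp add: F_class_def)
  qed
  show "1 \<le> (SUP G\<in>F_class \<sigma>. B_functional G)"
    using scaled_rademacher_in_F_class B_functional_scaled_rademacher[OF assms]
    by (metis SUP_upper)
qed

end
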